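(* Let $f_1,f_2:\mathbb{R}^d\to\mathbb{R}$ be in $\mathcal{C}^2$, $x_0\in\mathbb{R}^d$, $\bar\Delta>0$, and for $i\in\{1,2\}$ let $\{\widetilde f_{i,\Delta}\}_{\Delta\in(0,\bar\Delta]}$ be a class of (twice differentiable) models of $f_i$. Put $F=f_1f_2$ and $\widetilde F_\Delta=\widetilde f_{1,\Delta}\widetilde f_{2,\Delta}$. Suppose that for $i\in\{1,2\}$ the class $\{\widetilde f_{i,\Delta}\}_{(0,\bar\Delta]}$ provides order-$\infty$ function accuracy of $f_i$ at $x_0$ with constant $\kappa_i^f(x_0)=0$, order-$N_i^g$ gradient accuracy of $f_i$ at $x_0$ with constant $\kappa_i^g(x_0)$, and order-$N_i^h$ Hessian accuracy of $f_i$ at $x_0$ with constant $\kappa_i^h(x_0)$, where $N_i^g,N_i^h\ge0$. Let $N_F^{gh}=\min\{N_1^g,N_2^g,N_1^h,N_2^h\}$. Then for every $\Delta\in(0,\bar\Delta]$ $$\|\nabla^2F(x_0)-\nabla^2\widetilde F_\Delta(x_0)\|\le K_F^h(x_0)\Delta^{N_F^{gh}},$$ where $$\begin{aligned}K_F^h(x_0)=&\,(M_{\nabla f_2}(x_0)+M_{\nabla\widetilde f_2}(x_0))\kappa_1^g(x_0)\bar\Delta^{N_1^g-N_F^{gh}}+(M_{\nabla f_1}(x_0)+M_{\nabla\widetilde f_1}(x_0))\kappa_2^g(x_0)\bar\Delta^{N_2^g-N_F^{gh}}\\&+|f_2(x_0)|\kappa_1^h(x_0)\bar\Delta^{N_1^h-N_F^{gh}}+|f_1(x_0)|\kappa_2^h(x_0)\bar\Delta^{N_2^h-N_F^{gh}}.\end{aligned}$$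 In particular, $\{\widetilde F_\Delta\}_{(0,\bar\Delta]}$ provides order-$N_F^{gh}$ Hessian accuracy of $F$ at $x_0$.
   Context: $\|\cdot\|$ is the Euclidean norm for vectors and the induced operator norm for matrices; $B_\Delta(x_0)$ is the closed ball of radius $\Delta$ centered at $x_0$. A class of models of $f:\mathbb{R}^d\to\mathbb{R}$ is a family of functions $\widetilde f_\Delta:\mathbb{R}^d\to\mathbb{R}$ indexed by $\Delta\in(0,\bar\Delta]$; when gradients or Hessians of models appear the models are understood to be differentiable, respectively twice differentiable. Order-$\infty$ function accuracy of $f$ at $x_0$ with constant $0$ means $\widetilde f_\Delta(x_0)=f(x_0)$ for all $\Delta\in(0,\bar\Delta]$. For real $N\ge0$ and $\kappa\ge0$, the class provides order-$N$ gradient (respectively Hessian) accuracy of $f$ at $x_0$ with constant $\kappa$ if $\|\nabla f(x_0)-\nabla\widetilde f_\Delta(x_0)\|\le\kappa\Delta^N$ (respectively $\|\nabla^2 f(x_0)-\nabla^2\widetilde f_\Delta(x_0)\|\le\kappa\Delta^N$) for all $\Delta\in(0,\bar\Delta]$. Without mention of a constant, it is meant that some such $\kappa\ge0$ exists. Bounds: $M_{\nabla f_i}(x_0)$ denotes a number with $\|\nabla f_i(x)\|\le M_{\nabla f_i}(x_0)$ for all $x\in B_{\bar\Delta}(x_0)$; $M_{\nabla\widetilde f_i}(x_0)$ denotes a number with $\|\nabla\widetilde f_{i,\Delta}(x_0)\|\le M_{\nabla\widetilde f_i}(x_0)$ for all $\Delta\in(0,\bar\Delta]$ (it exists; one may take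 $\bar\Delta^{N_i^g}\kappa_i^g(x_0)+M_{\nabla f_i}(x_0)$). *)

theory Defs
  imports "HOL-Analysis.Analysis"
begin

definition gradient :: "(real ^ 'n \<Rightarrow> real) \<Rightarrow> real ^ 'n \<Rightarrow> real ^ 'n" where
  "gradient f x = (THE D. GDERIV f x :> D)"

text \<open>Row \<open>i\<close>, column \<open>j\<close> holds the derivative of the \<open>i\<close>-th component of the gradient in
  direction \<open>j\<close>.\<close>

definition hessian :: "(real ^ 'n \<Rightarrow> real) \<Rightarrow> real ^ 'n \<Rightarrow> real ^ 'n ^ 'n" where
  "hessian f x = jacobian (gradient f) (at x)"

text \<open>The norm of type class \<open>real_normed_vector\<close> on \<open>real ^ 'n ^ 'n\<close> is the Frobenius norm, so
  the operator norm induced by the Euclidean norm needs its own name.\<close>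

definition op_norm :: "real ^ 'n ^ 'm \<Rightarrow> real" where
  "op_norm A = onorm ((*v) A)"

definition twice_differentiable :: "(real ^ 'n \<Rightarrow> real) \<Rightarrow> bool" where
  "twice_differentiable f \<longleftrightarrow> f differentiable_on UNIV \<and> gradient f differentiable_on UNIV"

definition C2 :: "(real ^ 'n \<Rightarrow> real) \<Rightarrow> bool" where
  "C2 f \<longleftrightarrow> twice_differentiable f \<and> continuous_on UNIV (hessian f)"

text \<open>A class of models of \<open>f\<close> is a family \<open>m :: real \<Rightarrow> real ^ 'n \<Rightarrow> real\<close> of which only the
  members with index in \<open>{0<..\<Delta>max}\<close> matter. Orders are real, hence \<open>powr\<close>; the base is always
  positive.\<close>

definition infinite_order_function_accuracy0 ::
  "(real ^ 'n \<Rightarrow> real) \<Rightarrow> (real \<Rightarrow> real ^ 'n \<Rightarrow> real) \<Rightarrow> real \<Rightarrow> real ^ 'n \<Rightarrow> bool" where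
  "infinite_order_function_accuracy0 f m \<Delta>max x0 \<longleftrightarrow> (\<forall>\<Delta>\<in>{0<..\<Delta>max}. m \<Delta> x0 = f x0)"

definition gradient_accuracy_const ::
  "(real ^ 'n \<Rightarrow> real) \<Rightarrow> (real \<Rightarrow> real ^ 'n \<Rightarrow> real) \<Rightarrow> real \<Rightarrow> real ^ 'n \<Rightarrow> real \<Rightarrow> real \<Rightarrow> bool" where
  "gradient_accuracy_const f m \<Delta>max x0 N \<kappa> \<longleftrightarrow> N \<ge> 0 \<and> \<kappa> \<ge> 0 \<and>
     (\<forall>\<Delta>\<in>{0<..\<Delta>max}. norm (gradient f x0 - gradient (m \<Delta>) x0) \<le> \<kappa> * \<Delta> powr N)"

definition hessian_accuracy_const ::
  "(real ^ 'n \<Rightarrow> real) \<Rightarrow> (real \<Rightarrow> real ^ 'n \<Rightarrow> real) \<Rightarrow> real \<Rightarrow> real ^ 'n \<Rightarrow> real \<Rightarrow> real \<Rightarrow> bool" where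
  "hessian_accuracy_const f m \<Delta>max x0 N \<kappa> \<longleftrightarrow> N \<ge> 0 \<and> \<kappa> \<ge> 0 \<and>
     (\<forall>\<Delta>\<in>{0<..\<Delta>max}. op_norm (hessian f x0 - hessian (m \<Delta>) x0) \<le> \<kappa> * \<Delta> powr N)"

definition hessian_accuracy ::
  "(real ^ 'n \<Rightarrow> real) \<Rightarrow> (real \<Rightarrow> real ^ 'n \<Rightarrow> real) \<Rightarrow> real \<Rightarrow> real ^ 'n \<Rightarrow> real \<Rightarrow> bool" where
  "hessian_accuracy f m \<Delta>max x0 N \<longleftrightarrow> (\<exists>\<kappa>. hessian_accuracy_const f m \<Delta>max x0 N \<kappa>)"

lemma gradient_eqI:
  assumes "GDERIV f x :> D"
  shows "gradient f x = D"
  unfolding gradient_def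
proof (rule the_equality)
  fix E assume "GDERIV f x :> E"
  with assms have "(\<lambda>h. inner h E) = (\<lambda>h. inner h D)"
    unfolding gderiv_def by (rule has_derivative_unique[rotated])
  then show "E = D"
    by (metis inner_commute vector_eq_rdot)
qed fact

lemma GDERIV_gradient:
  fixes f :: "real ^ 'n \<Rightarrow> real"
  assumes "f differentiable (at x)"
  shows "GDERIV f x :> gradient f x"
proof -
  obtain f' where f': "(f has_derivative f') (at x)"
    using assms by (auto simp: differentiable_def)
  then have "linear f'"
    by (rule has_derivative_linear)
  then have "f' = (\<lambda>h. inner h (adjoint f' 1))"
    using adjoint_works[of f' _ 1] by (simp add: fun_eq_iff inner_commute)
  with f' have "GDERIV f x :> adjoint f' 1"
    unfolding gderiv_def by metis
  with gradient_eqI[OF this] show ?thesis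
    by simp
qed

lemma hessian_eqI:
  assumes "(gradient f has_derivative (*v) H) (at x)"
  shows "hessian f x = H"
  unfolding hessian_def jacobian_def frechet_derivative_at[OF assms, symmetric] by simp

lemma hessian_works:
  assumes "twice_differentiable f"
  shows "(gradient f has_derivative (*v) (hessian f x)) (at x)"
proof -
  have "gradient f differentiable (at x)"
    using assms by (simp add: twice_differentiable_def differentiable_on_def)
  then show ?thesis
    unfolding hessian_def jacobian_works .
qed

end

theory Submission
  imports Defs
begin

text \<open>By the product rule, \<open>\<nabla>\<^sup>2(f g) = f \<nabla>\<^sup>2g + g \<nabla>\<^sup>2f + \<nabla>f \<nabla>g\<^sup>T + \<nabla>g \<nabla>f\<^sup>T\<close>. Models that are exact
  at \<open>x0\<close> have the same scalar coefficients there, so the two Hessian terms contribute the Hessian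
  errors of the factors. Each difference of rank-one terms telescopes as
  \<open>u v\<^sup>T - u' v'\<^sup>T = (u - u') v\<^sup>T + u' (v - v')\<^sup>T\<close>. The powers of \<open>\<Delta>\<close> are brought to the common
  exponent by \<open>\<Delta>\<^sup>N \<le> \<Delta>max\<^sup>N\<^sup>-\<^sup>M \<Delta>\<^sup>M\<close> for \<open>M \<le> N\<close>.\<close>

lemma gradient_mult:
  fixes f g :: "real ^ 'n \<Rightarrow> real"
  assumes "f differentiable (at x)" and "g differentiable (at x)"
  shows "gradient (\<lambda>x. f x * g x) x = f x *\<^sub>R gradient g x + g x *\<^sub>R gradient f x"
  by (intro gradient_eqI GDERIV_mult GDERIV_gradient assms)

text \<open>Differentiating the product rule for the gradient once more gives the formula. It is
  stated through the action on a vector \<open>v\<close>, so that the rank-one parts become scalar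
  multiples of gradients and no outer product has to be named.\<close>

lemma hessian_mult_vector:
  fixes f g :: "real ^ 'n \<Rightarrow> real"
  assumes f: "twice_differentiable f" and g: "twice_differentiable g"
  shows "hessian (\<lambda>x. f x * g x) x *v v =
    f x *\<^sub>R (hessian g x *v v) + g x *\<^sub>R (hessian f x *v v)
    + (v \<bullet> gradient f x) *\<^sub>R gradient g x + (v \<bullet> gradient g x) *\<^sub>R gradient f x"
proof -
  let ?G = "\<lambda>x. f x *\<^sub>R gradient g x + g x *\<^sub>R gradient f x"
  let ?D = "\<lambda>v. (f x *\<^sub>R (hessian g x *v v) + (v \<bullet> gradient f x) *\<^sub>R gradient g x)
    + (g x *\<^sub>R (hessian f x *v v) + (v \<bullet> gradient g x) *\<^sub>R gradient f x)"
  have diff: "f differentiable (at y)" "g differentiable (at y)" for y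
    using f g by (simp_all add: twice_differentiable_def differentiable_on_def)
  then have grad: "gradient (\<lambda>x. f x * g x) = ?G"
    by (simp add: fun_eq_iff gradient_mult)
  have "(f has_derivative (\<lambda>v. v \<bullet> gradient f x)) (at x)"
      "(g has_derivative (\<lambda>v. v \<bullet> gradient g x)) (at x)"
    using GDERIV_gradient[OF diff(1)] GDERIV_gradient[OF diff(2)] by (simp_all add: gderiv_def)
  then have D: "(?G has_derivative ?D) (at x)"
    by (intro has_derivative_add has_derivative_scaleR hessian_works f g)
  \<comment> \<open>As a derivative, \<open>?D\<close> is linear, hence the action of its matrix;
    this is the shape that \<open>hessian_eqI\<close> asks for.\<close>
  have mat: "?D = (*v) (matrix ?D)"
    by (rule ext) (simp only: matrix_works[OF has_derivative_linear[OF D, folded linear_matrix_vector_mul_eq]])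
  have "(gradient (\<lambda>x. f x * g x) has_derivative (*v) (matrix ?D)) (at x)"
    unfolding grad mat[symmetric] by (rule D)
  then have "hessian (\<lambda>x. f x * g x) x = matrix ?D"
    by (rule hessian_eqI)
  then have "hessian (\<lambda>x. f x * g x) x *v v = ?D v"
    by (simp only: fun_cong[OF mat, symmetric])
  then show ?thesis
    by (simp add: algebra_simps)
qed

lemma op_norm_le:
  assumes "\<And>v. norm (A *v v) \<le> b * norm v"
  shows "op_norm A \<le> b"
  unfolding op_norm_def by (rule onorm_le) (rule assms)

lemma norm_matrix_vector_le_op_norm: "norm (A *v v) \<le> op_norm A * norm v"
  unfolding op_norm_def by (rule onorm[OF matrix_vector_mul_bounded_linear])

text \<open>\<open>(w \<bullet> v) *\<^sub>R u\<close> is the rank-one matrix with column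
  \<open>u\<close> and row \<open>v\<close> applied to \<open>w\<close>, so telescoping and
  Cauchy-Schwarz suffice.\<close>

lemma norm_rank_one_diff_le:
  fixes u u' v v' w :: "'a::real_inner"
  shows "norm ((w \<bullet> v) *\<^sub>R u - (w \<bullet> v') *\<^sub>R u')
    \<le> (norm (u - u') * norm v + norm u' * norm (v - v')) * norm w"
proof -
  have "(w \<bullet> v) *\<^sub>R u - (w \<bullet> v') *\<^sub>R u' = (w \<bullet> v) *\<^sub>R (u - u') + (w \<bullet> (v - v')) *\<^sub>R u'"
    by (simp add: algebra_simps)
  also have "norm \<dots> \<le> \<bar>w \<bullet> v\<bar> * norm (u - u') + \<bar>w \<bullet> (v - v')\<bar> * norm u'"
    by (metis norm_scaleR norm_triangle_ineq)
  also have "\<dots> \<le> (norm w * norm v) * norm (u - u') + (norm w * norm (v - v')) * norm u'"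
    by (intro add_mono mult_right_mono Cauchy_Schwarz_ineq2) auto
  finally show ?thesis
    by (simp add: algebra_simps)
qed

lemma op_norm_hessian_mult_diff_le:
  fixes f g p q :: "real ^ 'n \<Rightarrow> real"
  assumes "twice_differentiable f" "twice_differentiable g"
    and "twice_differentiable p" "twice_differentiable q"
    and eq: "p x = f x" "q x = g x"
  shows "op_norm (hessian (\<lambda>x. f x * g x) x - hessian (\<lambda>x. p x * q x) x)
    \<le> (norm (gradient g x) + norm (gradient q x)) * norm (gradient f x - gradient p x)
      + (norm (gradient f x) + norm (gradient p x)) * norm (gradient g x - gradient q x)
      + \<bar>g x\<bar> * op_norm (hessian f x - hessian p x)
      + \<bar>f x\<bar> * op_norm (hessian g x - hessian q x)" (is "_ \<le> ?b")
proof (rule op_norm_le)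
  fix v
  define H where "H = (hessian (\<lambda>x. f x * g x) x - hessian (\<lambda>x. p x * q x) x) *v v"
  define A where "A = f x *\<^sub>R ((hessian g x - hessian q x) *v v)"
  define B where "B = g x *\<^sub>R ((hessian f x - hessian p x) *v v)"
  define C where "C = (v \<bullet> gradient f x) *\<^sub>R gradient g x - (v \<bullet> gradient p x) *\<^sub>R gradient q x"
  define D where "D = (v \<bullet> gradient g x) *\<^sub>R gradient f x - (v \<bullet> gradient q x) *\<^sub>R gradient p x"
  \<comment> \<open>Exactness at \<open>x\<close> enters here: with \<open>p x = f x\<close> and
    \<open>q x = g x\<close>, the scalar coefficients agree and factor out of the Hessian
    differences.\<close>
  have "H = A + B + C + D"
    by (simp add: H_def A_def B_def C_def D_def matrix_vector_mult_diff_rdistrib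
        hessian_mult_vector assms scaleR_diff_right)
  then have "norm H \<le> norm A + norm B + norm C + norm D"
    by (metis norm_triangle_mono order_refl)
  moreover have "norm A \<le> \<bar>f x\<bar> * (op_norm (hessian g x - hessian q x) * norm v)"
    "norm B \<le> \<bar>g x\<bar> * (op_norm (hessian f x - hessian p x) * norm v)"
    unfolding A_def B_def norm_scaleR
    by (intro mult_left_mono norm_matrix_vector_le_op_norm abs_ge_zero)+
  \<comment> \<open>The bounds for \<open>C\<close> and \<open>D\<close> complement each other: the
    error of \<open>gradient f x\<close> is weighted by the norm of \<open>gradient q x\<close> in
    \<open>C\<close> and of \<open>gradient g x\<close> in \<open>D\<close>, which sum to the
    coefficient in \<open>?b\<close>; likewise with the factors exchanged.\<close>
  moreover note norm_rank_one_diff_le[of v "gradient f x" "gradient g x" "gradient p x" "gradient q x",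
      folded C_def]
    norm_rank_one_diff_le[of v "gradient g x" "gradient f x" "gradient q x" "gradient p x",
      folded D_def]
  ultimately have "norm H \<le> ?b * norm v"
    by (simp add: algebra_simps)
  then show "norm ((hessian (\<lambda>x. f x * g x) x - hessian (\<lambda>x. p x * q x) x) *v v) \<le> ?b * norm v"
    unfolding H_def .
qed

lemma powr_le_mult_powr:
  fixes \<Delta> :: real
  assumes "0 < \<Delta>" "\<Delta> \<le> \<Delta>max" "M \<le> N"
  shows "\<Delta> powr N \<le> \<Delta>max powr (N - M) * \<Delta> powr M"
proof -
  have "\<Delta> powr N = \<Delta> powr (N - M) * \<Delta> powr M"
    by (simp flip: powr_add)
  also have "\<dots> \<le> \<Delta>max powr (N - M) * \<Delta> powr M"
    using assms by (intro mult_right_mono powr_mono2) auto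
  finally show ?thesis .
qed

text \<open>This treats one summand of the final constant: \<open>e\<close> is a model error,
  \<open>c\<close> its actual coefficient and \<open>d\<close> a bound for \<open>c\<close> that
  does not vary with \<open>\<Delta>\<close>.\<close>

lemma mult_powr_le:
  fixes \<Delta> :: real
  assumes "0 < \<Delta>" "\<Delta> \<le> \<Delta>max" "M \<le> N" "0 \<le> \<kappa>" "e \<le> \<kappa> * \<Delta> powr N" "0 \<le> c" "c \<le> d" "0 \<le> e"
  shows "c * e \<le> d * \<kappa> * \<Delta>max powr (N - M) * \<Delta> powr M"
proof -
  have "e \<le> \<kappa> * (\<Delta>max powr (N - M) * \<Delta> powr M)"
    using assms(5) mult_left_mono[OF powr_le_mult_powr[OF assms(1-3)] assms(4)] by linarith
  then have "c * e \<le> d * (\<kappa> * (\<Delta>max powr (N - M) * \<Delta> powr M))"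
    using assms by (intro mult_mono) auto
  then show ?thesis
    by (simp add: mult.assoc)
qed

theorem theorem12:
  fixes f1 f2 F :: "real ^ 'n \<Rightarrow> real"
    and m1 m2 mF :: "real \<Rightarrow> real ^ 'n \<Rightarrow> real"
    and x0 :: "real ^ 'n"
    and \<Delta>max N1g N2g N1h N2h NF \<kappa>1g \<kappa>2g \<kappa>1h \<kappa>2h :: real
  assumes "C2 f1" and "C2 f2"
    and "\<Delta>max > 0"
    and "\<forall>\<Delta>\<in>{0<..\<Delta>max}. twice_differentiable (m1 \<Delta>)"
    and "\<forall>\<Delta>\<in>{0<..\<Delta>max}. twice_differentiable (m2 \<Delta>)"
    and "F = (\<lambda>x. f1 x * f2 x)"
    and "mF = (\<lambda>\<Delta> x. m1 \<Delta> x * m2 \<Delta> x)"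
    and "infinite_order_function_accuracy0 f1 m1 \<Delta>max x0"
    and "infinite_order_function_accuracy0 f2 m2 \<Delta>max x0"
    and "gradient_accuracy_const f1 m1 \<Delta>max x0 N1g \<kappa>1g"
    and "gradient_accuracy_const f2 m2 \<Delta>max x0 N2g \<kappa>2g"
    and "hessian_accuracy_const f1 m1 \<Delta>max x0 N1h \<kappa>1h"
    and "hessian_accuracy_const f2 m2 \<Delta>max x0 N2h \<kappa>2h"
    and "NF = Min {N1g, N2g, N1h, N2h}"
  shows "(\<forall>Mf1 Mf2 Mm1 Mm2 :: real.
            (\<forall>x\<in>cball x0 \<Delta>max. norm (gradient f1 x) \<le> Mf1) \<longrightarrow>
            (\<forall>x\<in>cball x0 \<Delta>max. norm (gradient f2 x) \<le> Mf2) \<longrightarrow>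
            (\<forall>\<Delta>\<in>{0<..\<Delta>max}. norm (gradient (m1 \<Delta>) x0) \<le> Mm1) \<longrightarrow>
            (\<forall>\<Delta>\<in>{0<..\<Delta>max}. norm (gradient (m2 \<Delta>) x0) \<le> Mm2) \<longrightarrow>
            (\<forall>\<Delta>\<in>{0<..\<Delta>max}.
               op_norm (hessian F x0 - hessian (mF \<Delta>) x0)
                 \<le> ((Mf2 + Mm2) * \<kappa>1g * \<Delta>max powr (N1g - NF)
                    + (Mf1 + Mm1) * \<kappa>2g * \<Delta>max powr (N2g - NF)
                    + \<bar>f2 x0\<bar> * \<kappa>1h * \<Delta>max powr (N1h - NF)
                    + \<bar>f1 x0\<bar> * \<kappa>2h * \<Delta>max powr (N2h - NF)) * \<Delta> powr NF))
         \<and> hessian_accuracy F mF \<Delta>max x0 NF"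
proof -
  \<comment> \<open>The gradient bounds are parameters because the estimate is used twice: with
    arbitrary given bounds, and with explicit ones for the accuracy claim.\<close>
  define K where "K a b c d = (b + d) * \<kappa>1g * \<Delta>max powr (N1g - NF)
    + (a + c) * \<kappa>2g * \<Delta>max powr (N2g - NF)
    + \<bar>f2 x0\<bar> * \<kappa>1h * \<Delta>max powr (N1h - NF)
    + \<bar>f1 x0\<bar> * \<kappa>2h * \<Delta>max powr (N2h - NF)" for a b c d
  note acc = assms(10-13)[unfolded gradient_accuracy_const_def hessian_accuracy_const_def]
  have NF: "NF \<le> N1g" "NF \<le> N2g" "NF \<le> N1h" "NF \<le> N2h"
    unfolding assms(14) by (rule Min_le; simp)+
  \<comment> \<open>The minimum is attained, so \<open>NF\<close> inherits nonnegativity from the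
    orders.\<close>
  have "NF \<in> {N1g, N2g, N1h, N2h}"
    unfolding assms(14) by (rule Min_in) simp_all
  then have pos: "0 \<le> NF" "0 \<le> \<kappa>1g" "0 \<le> \<kappa>2g" "0 \<le> \<kappa>1h" "0 \<le> \<kappa>2h"
    using acc by blast+
  have bound: "op_norm (hessian F x0 - hessian (mF \<Delta>) x0) \<le> K a b c d * \<Delta> powr NF"
    if \<Delta>: "\<Delta> \<in> {0<..\<Delta>max}"
      and M: "norm (gradient f1 x0) \<le> a" "norm (gradient f2 x0) \<le> b"
        "norm (gradient (m1 \<Delta>) x0) \<le> c" "norm (gradient (m2 \<Delta>) x0) \<le> d" for \<Delta> a b c d
  proof -
    have \<Delta>': "0 < \<Delta>" "\<Delta> \<le> \<Delta>max"
      using \<Delta> by auto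
    have err: "norm (gradient f1 x0 - gradient (m1 \<Delta>) x0) \<le> \<kappa>1g * \<Delta> powr N1g"
      "norm (gradient f2 x0 - gradient (m2 \<Delta>) x0) \<le> \<kappa>2g * \<Delta> powr N2g"
      "op_norm (hessian f1 x0 - hessian (m1 \<Delta>) x0) \<le> \<kappa>1h * \<Delta> powr N1h"
      "op_norm (hessian f2 x0 - hessian (m2 \<Delta>) x0) \<le> \<kappa>2h * \<Delta> powr N2h"
      using acc \<Delta> by blast+
    have op_pos: "0 \<le> op_norm A" for A :: "real ^ 'n ^ 'n"
      unfolding op_norm_def by (rule onorm_pos_le[OF matrix_vector_mul_bounded_linear])
    have "op_norm (hessian F x0 - hessian (mF \<Delta>) x0)
      \<le> (norm (gradient f2 x0) + norm (gradient (m2 \<Delta>) x0))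
          * norm (gradient f1 x0 - gradient (m1 \<Delta>) x0)
        + (norm (gradient f1 x0) + norm (gradient (m1 \<Delta>) x0))
          * norm (gradient f2 x0 - gradient (m2 \<Delta>) x0)
        + \<bar>f2 x0\<bar> * op_norm (hessian f1 x0 - hessian (m1 \<Delta>) x0)
        + \<bar>f1 x0\<bar> * op_norm (hessian f2 x0 - hessian (m2 \<Delta>) x0)"
      using assms(1,2,4,5,8,9) \<Delta>
      unfolding assms(6,7) C2_def infinite_order_function_accuracy0_def
      by (intro op_norm_hessian_mult_diff_le) blast+
    also have "\<dots> \<le> K a b c d * \<Delta> powr NF"
      unfolding K_def distrib_right[of _ _ "\<Delta> powr NF"]
      by (intro add_mono mult_powr_le[OF \<Delta>' NF(1) pos(2) err(1)] mult_powr_le[OF \<Delta>' NF(2) pos(3) err(2)]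
          mult_powr_le[OF \<Delta>' NF(3) pos(4) err(3)] mult_powr_le[OF \<Delta>' NF(4) pos(5) err(4)]
          add_mono M op_pos) auto
    finally show ?thesis .
  qed
  \<comment> \<open>Gradient accuracy itself bounds the model gradients uniformly in
    \<open>\<Delta>\<close>, by the triangle inequality and monotonicity of the power for
    \<open>N \<ge> 0\<close>.\<close>
  have model_bound: "norm (gradient (m \<Delta>) x0) \<le> norm (gradient f x0) + \<kappa> * \<Delta>max powr N"
    if "gradient_accuracy_const f m \<Delta>max x0 N \<kappa>" "\<Delta> \<in> {0<..\<Delta>max}"
    for f :: "real ^ 'n \<Rightarrow> real" and m \<Delta> N \<kappa>
  proof -
    have "norm (gradient f x0 - gradient (m \<Delta>) x0) \<le> \<kappa> * \<Delta> powr N"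
      using that by (simp add: gradient_accuracy_const_def)
    also have "\<dots> \<le> \<kappa> * \<Delta>max powr N"
      using that by (auto simp: gradient_accuracy_const_def intro!: mult_left_mono powr_mono2)
    finally show ?thesis
      using norm_triangle_sub[of "gradient (m \<Delta>) x0" "gradient f x0"]
      by (simp add: norm_minus_commute)
  qed
  \<comment> \<open>The accuracy claim needs one nonnegative constant for all
    \<open>\<Delta>\<close>; it comes from the true gradient norms at \<open>x0\<close> and the
    uniform bounds of \<open>model_bound\<close>.\<close>
  define k where "k = K (norm (gradient f1 x0)) (norm (gradient f2 x0))
    (norm (gradient f1 x0) + \<kappa>1g * \<Delta>max powr N1g) (norm (gradient f2 x0) + \<kappa>2g * \<Delta>max powr N2g)"
  have "0 \<le> k"
    using pos by (simp add: k_def K_def)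
  moreover have "op_norm (hessian F x0 - hessian (mF \<Delta>) x0) \<le> k * \<Delta> powr NF"
    if "\<Delta> \<in> {0<..\<Delta>max}" for \<Delta>
    unfolding k_def
    using that by (intro bound order_refl model_bound[OF assms(10)] model_bound[OF assms(11)])
  ultimately have "hessian_accuracy F mF \<Delta>max x0 NF"
    using pos(1) unfolding hessian_accuracy_def hessian_accuracy_const_def by blast
  \<comment> \<open>Bounds over the ball are used only at its center.\<close>
  moreover have "x0 \<in> cball x0 \<Delta>max"
    using assms(3) by simp
  ultimately show ?thesis
    using bound unfolding K_def by blast
qed

end
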